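(* Let $\delta,\lambda>0$ be constants, $h\equiv 0$, and let $g(x)=\lambda-\lambda x^2$ for $|x|\le 1$ and $g(x)=0$ for $|x|>1$. Let $$\alpha=-\frac{1}{\sqrt{2\delta}}+\sqrt{\frac{1}{2\delta}+1}\in(0,1),\qquad A=\lambda(1-\alpha^2)e^{\sqrt{2\delta}\,\alpha}>0,$$ $$u(x)=\begin{cases}-\lambda x^2+\lambda,&|x|\le\alpha,\\ A e^{-\sqrt{2\delta}\,|x|},&|x|>\alpha.\end{cases}$$ Then $u$ is a candidate for the value function (as defined in the context) if and only if $$\alpha\le\frac{1}{2\lambda}\quad\Longleftrightarrow\quad\lambda\le\frac12\left(-\frac{1}{\sqrt{2\delta}}+\sqrt{\frac{1}{2\delta}+1}\right)^{-1}.$$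
   Context: Candidate for the value function (for the data $b\equiv0$, $\sigma\equiv1$, constant discount rate $\delta$, running payoff $h\equiv0$, terminal payoff $g$ as in the statement). Let $\mathcal{L}u(x)=\frac12u''(x)-\delta u(x)$. A candidate is a continuous $u:\mathbb{R}\to\mathbb{R}_+$ that is $C^1$ with absolutely continuous first derivative inside $\mathbb{R}\setminus\mathcal{B}$, where $\mathcal{B}$ is a finite set, that satisfies $|u'(x)|\le 1$ for all $x\in\mathbb{R}\setminus\mathcal{B}$, and that has properties (i)–(iii) below, where $\mathcal{C}=\mathrm{cl}\big[\mathrm{int}\{x\in\mathbb{R}\setminus\mathcal{B}: |u'(x)|=1\}\big]$, $\mathcal{S}_{\mathcal W}=\{x: u(x)=g(x)\}$, $\mathcal{S}_{\mathcal C}=\mathrm{cl}\{x: u(x)<g(x)\}$, $\mathcal{S}=\mathcal{S}_{\mathcal W}\cup\mathcal{S}_{\mathcal C}$, $\mathcal{W}=\mathbb{R}\setminus(\mathcal{C}\cup\mathcal{S})$: (i) each of $\mathcal{C},\mathcal{S}_{\mathcal W},\mathcal{S}_{\mathcal C}$ is a finite union of intervals (single points allowed), and $\mathcal{B}\subseteq\mathcal{S}_{\mathcal C}\subseteq\mathcal{C}$; (ii) $\mathcal{L}u+h=0$ Lebesgue-a.e. in $\mathcal{W}$; $\mathcal{L}u+h\ge0$ a.e. in $\mathrm{int}(\mathcal{C}\setminus\mathcal{S})$; $\mathcal{L}u+h=\mathcal{L}g+h\le0$ a.e. in $\mathrm{int}\,\mathcal{S}_{\mathcal W}$ (no sign condition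 in $\mathrm{int}\,\mathcal{S}_{\mathcal C}\setminus\mathcal{B}$); (iii) for every $c\in\mathcal{B}$, with $u'_\mp(c)$ the left/right derivatives, either $u'_-(c)=1$ and $u'_+(c)<1$, or $u'_-(c)>-1$ and $u'_+(c)=-1$. The displayed "$\Longleftrightarrow$" in the claim means that the two inequalities are equivalent forms of the same condition. *)

theory Defs
  imports "HOL-Analysis.Analysis"
begin

text \<open>
  Absolute continuity on a compact interval; the finite family of non-overlapping compact
  subintervals is a division of its own union.
\<close>

definition abs_continuous_on :: "real \<Rightarrow> real \<Rightarrow> (real \<Rightarrow> real) \<Rightarrow> bool" where
  "abs_continuous_on a b f \<longleftrightarrow>
     (\<forall>\<epsilon>>0. \<exists>\<eta>>0. \<forall>D. D division_of \<Union>D \<and> \<Union>D \<subseteq> {a..b} \<and> (\<Sum>K\<in>D. Sup K - Inf K) < \<eta>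
        \<longrightarrow> (\<Sum>K\<in>D. \<bar>f (Sup K) - f (Inf K)\<bar>) < \<epsilon>)"

text \<open>Absolute continuity inside a set that need not be bounded or closed is meant locally.\<close>

definition locally_abs_continuous_on :: "real set \<Rightarrow> (real \<Rightarrow> real) \<Rightarrow> bool" where
  "locally_abs_continuous_on X f \<longleftrightarrow>
     (\<forall>a b. a \<le> b \<longrightarrow> {a..b} \<subseteq> X \<longrightarrow> abs_continuous_on a b f)"

definition finite_union_of_intervals :: "real set \<Rightarrow> bool" where
  "finite_union_of_intervals X \<longleftrightarrow> (\<exists>F. finite F \<and> (\<forall>I\<in>F. is_interval I) \<and> X = \<Union>F)"

text \<open>
  The operator \<open>u''/2 - \<delta> u\<close>. It is only used almost everywhere on sets where the first
  derivative is locally absolutely continuous up to finitely many points, so that the second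
  derivative exists almost everywhere there.
\<close>

definition generator :: "real \<Rightarrow> (real \<Rightarrow> real) \<Rightarrow> real \<Rightarrow> real" where
  "generator \<delta> u x = 1/2 * deriv (deriv u) x - \<delta> * u x"

definition control_set :: "real set \<Rightarrow> (real \<Rightarrow> real) \<Rightarrow> real set" where
  "control_set B u = closure (interior {x. x \<notin> B \<and> \<bar>deriv u x\<bar> = 1})"

definition stop_set_W :: "(real \<Rightarrow> real) \<Rightarrow> (real \<Rightarrow> real) \<Rightarrow> real set" where
  "stop_set_W g u = {x. u x = g x}"

definition stop_set_C :: "(real \<Rightarrow> real) \<Rightarrow> (real \<Rightarrow> real) \<Rightarrow> real set" where
  "stop_set_C g u = closure {x. u x < g x}"

definition stop_set :: "(real \<Rightarrow> real) \<Rightarrow> (real \<Rightarrow> real) \<Rightarrow> real set" where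
  "stop_set g u = stop_set_W g u \<union> stop_set_C g u"

definition waiting_set :: "real set \<Rightarrow> (real \<Rightarrow> real) \<Rightarrow> (real \<Rightarrow> real) \<Rightarrow> real set" where
  "waiting_set B g u = - (control_set B u \<union> stop_set g u)"

definition candidate_with ::
    "real \<Rightarrow> (real \<Rightarrow> real) \<Rightarrow> (real \<Rightarrow> real) \<Rightarrow> real set \<Rightarrow> (real \<Rightarrow> real) \<Rightarrow> bool" where
  "candidate_with \<delta> h g B u \<longleftrightarrow>
     finite B \<and>
     continuous_on UNIV u \<and> (\<forall>x. 0 \<le> u x) \<and>
     u C1_differentiable_on (- B) \<and> locally_abs_continuous_on (- B) (deriv u) \<and>
     (\<forall>x. x \<notin> B \<longrightarrow> \<bar>deriv u x\<bar> \<le> 1) \<and>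
     finite_union_of_intervals (control_set B u) \<and>
     finite_union_of_intervals (stop_set_W g u) \<and>
     finite_union_of_intervals (stop_set_C g u) \<and>
     B \<subseteq> stop_set_C g u \<and> stop_set_C g u \<subseteq> control_set B u \<and>
     (AE x in lborel. x \<in> waiting_set B g u \<longrightarrow> generator \<delta> u x + h x = 0) \<and>
     (AE x in lborel. x \<in> interior (control_set B u - stop_set g u) \<longrightarrow>
        generator \<delta> u x + h x \<ge> 0) \<and>
     (AE x in lborel. x \<in> interior (stop_set_W g u) \<longrightarrow>
        generator \<delta> u x + h x = generator \<delta> g x + h x \<and> generator \<delta> g x + h x \<le> 0) \<and>
     (\<forall>c\<in>B. \<exists>l r.
        (u has_real_derivative l) (at_left c) \<and> (u has_real_derivative r) (at_right c) \<and>
        (l = 1 \<and> r < 1 \<or> l > -1 \<and> r = -1))"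

definition is_candidate ::
    "real \<Rightarrow> (real \<Rightarrow> real) \<Rightarrow> (real \<Rightarrow> real) \<Rightarrow> (real \<Rightarrow> real) \<Rightarrow> bool" where
  "is_candidate \<delta> h g u \<longleftrightarrow> (\<exists>B. candidate_with \<delta> h g B u)"

end

theory Submission
  imports Defs
begin

text \<open>
  Write \<open>k = sqrt (2 * \<delta>)\<close>. The threshold \<open>\<alpha>\<close> is the positive root of \<open>k * (1 - \<alpha>\<^sup>2) = 2 * \<alpha>\<close>
  (\<open>threshold_properties\<close>). This equation is the smooth fit condition: it makes the slopes
  \<open>- 2 * lam * \<alpha>\<close> of the parabola and \<open>- k * lam * (1 - \<alpha>\<^sup>2)\<close> of the exponential agree at \<open>\<alpha>\<close>, so
  that \<open>u\<close> is continuously differentiable on the whole line, with a Lipschitz derivative.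

  Smooth fit also makes the exponential branch lie strictly above the payoff. Since
  \<open>exp (- t) \<ge> 1 - t\<close>, it lies above its tangent at \<open>\<alpha>\<close>; this is also the tangent of the concave
  parabola there, and it exceeds the parabola by \<open>lam * (x - \<alpha>)\<^sup>2\<close> (\<open>payoff_less_value_fn\<close>).
  The case \<open>x < -\<alpha>\<close> follows by symmetry. Hence \<open>u < g\<close> nowhere, the set \<open>stop_set_C\<close> is empty, and
  the inclusion \<open>B \<subseteq> stop_set_C\<close> forces the exceptional set \<open>B\<close> to be empty.

  With \<open>B\<close> empty, being a candidate requires \<open>\<bar>u'\<bar> \<le> 1\<close> everywhere. The modulus of \<open>u'\<close> grows linearly
  up to \<open>\<bar>x\<bar> = \<alpha>\<close> and decays exponentially afterwards, so its maximum is \<open>2 * lam * \<alpha>\<close> and it is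
  attained only at \<open>\<alpha>\<close> and \<open>-\<alpha>\<close> (\<open>abs_slope_less\<close>). This yields the necessary condition
  \<open>2 * lam * \<alpha> \<le> 1\<close>. It is also sufficient: \<open>\<bar>u'\<bar> = 1\<close> then holds at most at two points, so the
  control set is empty, the waiting set is \<open>\<bar>x\<bar> > \<alpha>\<close>, where the exponential solves \<open>u'' = k\<^sup>2 * u\<close>, and
  on \<open>\<bar>x\<bar> < \<alpha>\<close> the function is concave and nonnegative, which gives the sign of the generator.
\<close>

section \<open>Gluing derivatives, and absolute continuity\<close>

text \<open>
  The difference quotients of both branches at \<open>c\<close> have the same limit, so they may be
  mixed in any pattern \<open>P\<close>. With \<open>P y\<close> as \<open>\<bar>y\<bar> \<le> \<alpha>\<close> this handles both \<open>c = \<alpha>\<close> and \<open>c = -\<alpha>\<close>.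
\<close>

lemma has_real_derivative_If:
  fixes p q :: "real \<Rightarrow> real"
  assumes p: "(p has_real_derivative D) (at c)" and q: "(q has_real_derivative D) (at c)"
    and "p c = q c"
  shows "((\<lambda>x. if P x then p x else q x) has_real_derivative D) (at c)"
proof -
  have "(\<lambda>y. ((if P y then p y else q y) - (if P c then p c else q c)) / (y - c))
      = (\<lambda>y. if P y then (p y - p c) / (y - c) else (q y - q c) / (y - c))"
    using \<open>p c = q c\<close> by (auto simp: fun_eq_iff)
  moreover have "((\<lambda>y. if P y then (p y - p c) / (y - c) else (q y - q c) / (y - c)) \<longlongrightarrow> D) (at c)"
    using p q unfolding has_field_derivative_iff
    by (intro filterlim_If) (auto intro: filterlim_mono[OF _ order_refl inf.cobounded1])
  ultimately show ?thesis
    unfolding has_field_derivative_iff by simp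
qed

lemma lipschitz_imp_abs_continuous_on:
  assumes lip: "L-lipschitz_on {a..b} f"
  shows "abs_continuous_on a b f"
  unfolding abs_continuous_on_def
proof (intro allI impI)
  fix \<epsilon> :: real assume "\<epsilon> > 0"
  have L: "L \<ge> 0" using lip by (rule lipschitz_on_nonneg)
  show "\<exists>\<eta>>0. \<forall>D. D division_of \<Union>D \<and> \<Union>D \<subseteq> {a..b} \<and> (\<Sum>K\<in>D. Sup K - Inf K) < \<eta>
        \<longrightarrow> (\<Sum>K\<in>D. \<bar>f (Sup K) - f (Inf K)\<bar>) < \<epsilon>"
  proof (intro exI[of _ "\<epsilon> / (L + 1)"] conjI allI impI)
    show "\<epsilon> / (L + 1) > 0" using \<open>\<epsilon> > 0\<close> L by simp
  next
    fix D assume D: "D division_of \<Union>D \<and> \<Union>D \<subseteq> {a..b} \<and> (\<Sum>K\<in>D. Sup K - Inf K) < \<epsilon> / (L + 1)"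
    have step: "\<bar>f (Sup K) - f (Inf K)\<bar> \<le> L * (Sup K - Inf K) \<and> 0 \<le> Sup K - Inf K"
      if "K \<in> D" for K
    proof -
      have "K \<noteq> {}" and "\<exists>c d. K = cbox c d"
        using D division_ofD(3,4) that by blast+
      then obtain c d where K: "K = {c..d}" "c \<le> d"
        by auto
      have "c \<in> {a..b}" "d \<in> {a..b}" using D that K by fastforce+
      then show ?thesis
        using lipschitz_onD[OF lip, of d c] K by (simp add: dist_real_def)
    qed
    have "(\<Sum>K\<in>D. \<bar>f (Sup K) - f (Inf K)\<bar>) \<le> L * (\<Sum>K\<in>D. Sup K - Inf K)"
      unfolding sum_distrib_left by (intro sum_mono) (use step in auto)
    also have "\<dots> \<le> L * (\<epsilon> / (L + 1))"
      using D L by (intro mult_left_mono) auto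
    also have "\<dots> < \<epsilon>"
      using L \<open>\<epsilon> > 0\<close> by (simp add: field_simps)
    finally show "(\<Sum>K\<in>D. \<bar>f (Sup K) - f (Inf K)\<bar>) < \<epsilon>" .
  qed
qed

section \<open>The stopping threshold\<close>

lemma threshold_properties:
  fixes k \<alpha> :: real
  assumes "k > 0" and \<alpha>: "\<alpha> = - (1 / k) + sqrt (1 / k\<^sup>2 + 1)"
  shows "0 < \<alpha>" and "\<alpha> < 1" and "k * (1 - \<alpha>\<^sup>2) = 2 * \<alpha>"
proof -
  have eq: "(\<alpha> + 1 / k)\<^sup>2 = (1 / k)\<^sup>2 + 1"
    using \<alpha> by (simp add: power_divide add_nonneg_pos less_imp_le)
  have "1 / k < sqrt (1 / k\<^sup>2 + 1)"
    by (rule real_less_rsqrt) (simp add: power_divide)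
  then show pos: "0 < \<alpha>" using \<alpha> by simp
  show smooth: "k * (1 - \<alpha>\<^sup>2) = 2 * \<alpha>"
  proof -
    have "k * (k * (1 - \<alpha>\<^sup>2)) = k * (2 * \<alpha>)"
      using eq \<open>k > 0\<close> by (simp add: power2_eq_square field_simps)
    then show ?thesis using \<open>k > 0\<close> by simp
  qed
  have "1 - \<alpha>\<^sup>2 > 0"
    using smooth pos \<open>k > 0\<close> by (metis mult_pos_pos zero_less_mult_pos zero_less_numeral)
  then show "\<alpha> < 1"
    using pos by (simp add: power_less_one_iff)
qed

text \<open>
  The discount rate enters as \<open>\<delta> = k\<^sup>2 / 2\<close>. The explicit square-root formula for \<open>\<alpha>\<close> is replaced by
  the properties that the argument rests on: smooth fit, and \<open>\<alpha>\<close> lying between 0 and 1.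
\<close>

locale smooth_fit =
  fixes k lam \<alpha> :: real
  assumes k_pos: "k > 0" and lam_pos: "lam > 0" and \<alpha>_pos: "\<alpha> > 0" and \<alpha>_less_1: "\<alpha> < 1"
    and smooth_fit: "k * (1 - \<alpha>\<^sup>2) = 2 * \<alpha>"
begin

definition payoff :: "real \<Rightarrow> real" where
  "payoff x = (if \<bar>x\<bar> \<le> 1 then lam - lam * x\<^sup>2 else 0)"

definition value_fn :: "real \<Rightarrow> real" where
  "value_fn x = (if \<bar>x\<bar> \<le> \<alpha> then lam - lam * x\<^sup>2
     else lam * (1 - \<alpha>\<^sup>2) * exp (- k * (\<bar>x\<bar> - \<alpha>)))"

text \<open>
  The derivative of \<open>value_fn\<close>, as one formula on the whole line: a product of two bounded
  Lipschitz functions, which makes its continuity and absolute continuity easy to obtain.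
\<close>

definition slope :: "real \<Rightarrow> real" where
  "slope x = - 2 * lam * max (- \<alpha>) (min \<alpha> x) * exp (- k * max 0 (\<bar>x\<bar> - \<alpha>))"

lemma slope_inside: "\<bar>x\<bar> \<le> \<alpha> \<Longrightarrow> slope x = - 2 * lam * x"
  by (simp add: slope_def)

lemma slope_outside: "\<alpha> \<le> \<bar>x\<bar> \<Longrightarrow> slope x = - 2 * lam * \<alpha> * sgn x * exp (- k * (\<bar>x\<bar> - \<alpha>))"
  using \<alpha>_pos by (cases "x > 0") (auto simp: slope_def abs_if sgn_if max_def min_def)

lemma has_real_derivative_exp_tail:
  assumes "x \<noteq> 0"
  shows "((\<lambda>y. exp (- k * (\<bar>y\<bar> - \<alpha>))) has_real_derivative
     - k * sgn x * exp (- k * (\<bar>x\<bar> - \<alpha>))) (at x)"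
proof -
  have "(abs has_real_derivative sgn x) (at x)"
  proof (cases "x > 0")
    case True
    have "((\<lambda>y. y) has_real_derivative sgn x) (at x)"
      using True by (auto intro!: derivative_eq_intros)
    then show ?thesis
      by (rule has_field_derivative_transform_within_open[of _ _ _ "{0<..}"]) (use True in auto)
  next
    case False
    have "(uminus has_real_derivative sgn x) (at x)"
      using False assms by (auto intro!: derivative_eq_intros)
    then show ?thesis
      by (rule has_field_derivative_transform_within_open[of _ _ _ "{..<0}"])
        (use False assms in auto)
  qed
  then show ?thesis
    by (auto intro!: derivative_eq_intros)
qed

section \<open>Regularity of the candidate\<close>

text \<open>
  Away from \<open>\<bar>x\<bar> = \<alpha>\<close> one of the branches can be differentiated in a neighbourhood; at \<open>\<bar>x\<bar> = \<alpha>\<close> the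
  smooth fit equation turns the slope of the exponential into that of the parabola.
\<close>

lemma value_fn_deriv: "(value_fn has_real_derivative slope x) (at x)"
proof -
  let ?p = "\<lambda>y. lam - lam * y\<^sup>2"
  let ?q = "\<lambda>y. lam * (1 - \<alpha>\<^sup>2) * exp (- k * (\<bar>y\<bar> - \<alpha>))"
  have p: "(?p has_real_derivative - 2 * lam * x) (at x)" for x
    by (auto intro!: derivative_eq_intros)
  have q: "(?q has_real_derivative slope x) (at x)" if "\<alpha> \<le> \<bar>x\<bar>" for x
  proof -
    have "x \<noteq> 0" using that \<alpha>_pos by auto
    then have "(?q has_real_derivative
        lam * (1 - \<alpha>\<^sup>2) * (- k * sgn x * exp (- k * (\<bar>x\<bar> - \<alpha>)))) (at x)"
      by (intro DERIV_cmult has_real_derivative_exp_tail)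
    moreover have "lam * (1 - \<alpha>\<^sup>2) * (- k * sgn x * exp (- k * (\<bar>x\<bar> - \<alpha>)))
      = slope x"
    proof -
      have "slope x = - lam * (2 * \<alpha>) * sgn x * exp (- k * (\<bar>x\<bar> - \<alpha>))"
        by (simp add: slope_outside[OF that])
      then show ?thesis
        unfolding smooth_fit[symmetric] by (simp add: mult_ac)
    qed
    ultimately show ?thesis by metis
  qed
  consider "\<bar>x\<bar> < \<alpha>" | "\<bar>x\<bar> = \<alpha>" | "\<bar>x\<bar> > \<alpha>" by linarith
  then show ?thesis
  proof cases
    case 1
    have "(value_fn has_real_derivative - 2 * lam * x) (at x)"
      by (rule has_field_derivative_transform_within_open[OF p, of "{-\<alpha><..<\<alpha>}"])
        (use 1 in \<open>auto simp: value_fn_def\<close>)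
    then show ?thesis using 1 by (simp add: slope_inside)
  next
    case 2
    have "x\<^sup>2 = \<alpha>\<^sup>2" using 2 by (metis power2_abs)
    then have "?p x = ?q x" using 2 by (simp add: algebra_simps)
    then show ?thesis
      unfolding value_fn_def[abs_def] using p[of x] q[of x] 2
      by (intro has_real_derivative_If) (simp_all add: slope_inside)
  next
    case 3
    then show ?thesis
      by (intro has_field_derivative_transform_within_open[OF q, of x "{..<-\<alpha>} \<union> {\<alpha><..}"])
        (auto simp: value_fn_def)
  qed
qed

lemma deriv_value_fn: "deriv value_fn = slope"
  using value_fn_deriv DERIV_imp_deriv by blast

text \<open>
  The map \<open>exp (- s)\<close> is nonexpansive in \<open>s \<ge> 0\<close>, and the exponent is \<open>k\<close> times a nonexpansive
  function of \<open>x\<close>.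
\<close>

lemma exp_tail_lipschitz: "k-lipschitz_on UNIV (\<lambda>x. exp (- k * max 0 (\<bar>x\<bar> - \<alpha>)))"
proof -
  have *: "exp (- s) - exp (- t) \<le> \<bar>s - t\<bar>" if "0 \<le> s" for s t :: real
  proof -
    have "1 - exp (s - t) \<le> t - s"
      using exp_ge_add_one_self[of "s - t"] by linarith
    then have "exp (- s) * (1 - exp (s - t)) \<le> exp (- s) * (t - s)"
      by (rule mult_left_mono) simp
    also have "\<dots> \<le> exp (- s) * \<bar>s - t\<bar>"
      by (intro mult_left_mono) auto
    also have "\<dots> \<le> \<bar>s - t\<bar>"
      using that by (intro mult_left_le_one_le) auto
    finally show ?thesis by (simp add: right_diff_distrib flip: exp_add)
  qed
  have nonexp: "\<bar>exp (- s) - exp (- t)\<bar> \<le> \<bar>s - t\<bar>" if "0 \<le> s" "0 \<le> t" for s t :: real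
    using *[of s t] *[of t s] that by linarith
  show ?thesis
  proof (rule lipschitz_onI)
    fix x y :: real
    let ?s = "k * max 0 (\<bar>x\<bar> - \<alpha>)" and ?t = "k * max 0 (\<bar>y\<bar> - \<alpha>)"
    have "0 \<le> ?s" "0 \<le> ?t" using k_pos by auto
    then have "\<bar>exp (- ?s) - exp (- ?t)\<bar> \<le> \<bar>?s - ?t\<bar>"
      by (rule nonexp)
    also have "\<dots> = k * \<bar>max 0 (\<bar>x\<bar> - \<alpha>) - max 0 (\<bar>y\<bar> - \<alpha>)\<bar>"
      using k_pos by (simp only: abs_mult abs_of_pos right_diff_distrib[symmetric])
    also have "\<dots> \<le> k * \<bar>x - y\<bar>"
      using k_pos by (intro mult_left_mono) (auto simp: max_def)
    finally show "dist (exp (- k * max 0 (\<bar>x\<bar> - \<alpha>))) (exp (- k * max 0 (\<bar>y\<bar> - \<alpha>))) \<le> k * dist x y"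
      by (simp add: dist_real_def)
  qed (use k_pos in simp)
qed

lemma slope_lipschitz: "(2 * lam * (1 + \<alpha> * k))-lipschitz_on UNIV slope"
proof (rule lipschitz_onI)
  fix x y :: real
  define c where "c = (\<lambda>x. max (- \<alpha>) (min \<alpha> x))"
  define E where "E = (\<lambda>x. exp (- k * max 0 (\<bar>x\<bar> - \<alpha>)))"
  have c: "\<bar>c x - c y\<bar> \<le> \<bar>x - y\<bar>" "\<bar>c y\<bar> \<le> \<alpha>"
    using \<alpha>_pos by (auto simp: c_def max_def min_def)
  have "\<bar>E x\<bar> \<le> 1" using k_pos by (simp add: E_def)
  moreover have "\<bar>E x - E y\<bar> \<le> k * \<bar>x - y\<bar>"
    using lipschitz_onD[OF exp_tail_lipschitz, of x y] by (simp add: E_def dist_real_def)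
  ultimately have "\<bar>c x - c y\<bar> * \<bar>E x\<bar> + \<bar>c y\<bar> * \<bar>E x - E y\<bar>
      \<le> \<bar>x - y\<bar> * 1 + \<alpha> * (k * \<bar>x - y\<bar>)"
    using c \<alpha>_pos by (intro add_mono mult_mono) auto
  moreover have "c x * E x - c y * E y = (c x - c y) * E x + c y * (E x - E y)"
    by (simp add: algebra_simps)
  ultimately have "\<bar>c x * E x - c y * E y\<bar> \<le> (1 + \<alpha> * k) * \<bar>x - y\<bar>"
    using abs_triangle_ineq[of "(c x - c y) * E x" "c y * (E x - E y)"]
    unfolding abs_mult by (simp add: distrib_right mult.assoc)
  then have "2 * lam * \<bar>c x * E x - c y * E y\<bar> \<le> 2 * lam * ((1 + \<alpha> * k) * \<bar>x - y\<bar>)"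
    using lam_pos by (intro mult_left_mono) auto
  moreover have "slope x - slope y = - (2 * lam * (c x * E x - c y * E y))"
    by (simp add: slope_def c_def E_def algebra_simps)
  ultimately show "dist (slope x) (slope y) \<le> 2 * lam * (1 + \<alpha> * k) * dist x y"
    using lam_pos by (simp add: dist_real_def abs_mult)
qed (use lam_pos \<alpha>_pos k_pos in simp)

lemma slope_deriv_inside:
  assumes "\<bar>x\<bar> < \<alpha>"
  shows "deriv slope x = - 2 * lam"
proof (rule DERIV_imp_deriv)
  have "((\<lambda>y. - 2 * lam * y) has_real_derivative - 2 * lam) (at x)"
    by (auto intro!: derivative_eq_intros)
  then show "(slope has_real_derivative - 2 * lam) (at x)"
    by (rule has_field_derivative_transform_within_open[of _ _ _ "{-\<alpha><..<\<alpha>}"])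
      (use assms in \<open>auto simp: slope_inside\<close>)
qed

lemma slope_deriv_outside:
  assumes "\<alpha> < \<bar>x\<bar>"
  shows "deriv slope x = k\<^sup>2 * value_fn x"
proof (rule DERIV_imp_deriv)
  let ?e = "\<lambda>y. exp (- k * (\<bar>y\<bar> - \<alpha>))"
  have x: "x \<noteq> 0" using assms \<alpha>_pos by auto
  have "((\<lambda>y. - 2 * lam * \<alpha> * sgn x * ?e y) has_real_derivative
      - 2 * lam * \<alpha> * sgn x * (- k * sgn x * ?e x)) (at x)"
    by (intro DERIV_cmult has_real_derivative_exp_tail x)
  moreover have "- 2 * lam * \<alpha> * sgn x * (- k * sgn x * ?e x) = k\<^sup>2 * value_fn x"
  proof -
    have "sgn x * sgn x = 1" using x by (simp add: sgn_if)
    then have "- 2 * lam * \<alpha> * sgn x * (- k * sgn x * ?e x) = lam * k * (2 * \<alpha>) * ?e x"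
      by (simp add: algebra_simps)
    also have "\<dots> = k\<^sup>2 * value_fn x"
      unfolding smooth_fit[symmetric] using assms
      by (simp add: value_fn_def power2_eq_square algebra_simps)
    finally show ?thesis .
  qed
  ultimately have "((\<lambda>y. - 2 * lam * \<alpha> * sgn x * ?e y) has_real_derivative k\<^sup>2 * value_fn x) (at x)"
    by simp
  \<comment> \<open>The formula has the fixed factor \<open>sgn x\<close>, so it holds only on the side of the origin containing \<open>x\<close>.\<close>
  moreover define S where "S = (if x > 0 then {\<alpha><..} else {..<-\<alpha>})"
  have "slope y = - 2 * lam * \<alpha> * sgn x * ?e y" if "y \<in> S" for y
  proof -
    have "\<alpha> \<le> \<bar>y\<bar>" "sgn y = sgn x"
      using that x \<alpha>_pos by (auto simp: S_def sgn_if split: if_splits)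
    then show ?thesis by (simp add: slope_outside)
  qed
  moreover have "open S" "x \<in> S"
    using assms x by (auto simp: S_def)
  ultimately show "(slope has_real_derivative k\<^sup>2 * value_fn x) (at x)"
    by (intro has_field_derivative_transform_within_open[of _ _ _ S slope]) auto
qed

section \<open>The free boundary and the gradient bound\<close>

text \<open>
  The bound \<open>exp (- t) \<ge> 1 - t\<close> replaces the exponential by its tangent at \<open>\<alpha>\<close>. By smooth
  fit, the tangent minus the parabola is a perfect square, \<open>lam * (\<bar>x\<bar> - \<alpha>)\<^sup>2\<close>. For \<open>\<bar>x\<bar> > 1\<close> the payoff
  is zero and positivity is enough.
\<close>

lemma payoff_less_value_fn:
  assumes "\<alpha> < \<bar>x\<bar>"
  shows "payoff x < value_fn x"
proof -
  have \<alpha>2: "1 - \<alpha>\<^sup>2 > 0" using \<alpha>_pos \<alpha>_less_1 by (simp add: power_less_one_iff)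
  then have pos: "0 < value_fn x" using assms lam_pos by (simp add: value_fn_def)
  have "(1 - \<alpha>\<^sup>2) * (1 - k * (\<bar>x\<bar> - \<alpha>)) \<le> (1 - \<alpha>\<^sup>2) * exp (- k * (\<bar>x\<bar> - \<alpha>))"
    using exp_ge_add_one_self[of "- k * (\<bar>x\<bar> - \<alpha>)"] \<alpha>2 by (intro mult_left_mono) auto
  moreover have "(1 - \<alpha>\<^sup>2) * (1 - k * (\<bar>x\<bar> - \<alpha>)) = 1 - \<alpha>\<^sup>2 - (k * (1 - \<alpha>\<^sup>2)) * (\<bar>x\<bar> - \<alpha>)"
    by (simp add: algebra_simps)
  moreover have "\<dots> = 1 - x\<^sup>2 + (\<bar>x\<bar> - \<alpha>)\<^sup>2"
    unfolding smooth_fit by (simp add: power2_eq_square algebra_simps)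
  moreover have "(\<bar>x\<bar> - \<alpha>)\<^sup>2 > 0" using assms by simp
  ultimately have "1 - x\<^sup>2 < (1 - \<alpha>\<^sup>2) * exp (- k * (\<bar>x\<bar> - \<alpha>))" by linarith
  then have "lam * (1 - x\<^sup>2) < lam * ((1 - \<alpha>\<^sup>2) * exp (- k * (\<bar>x\<bar> - \<alpha>)))"
    using lam_pos by (rule mult_strict_left_mono)
  then show ?thesis
    using pos assms by (simp add: payoff_def value_fn_def algebra_simps)
qed

lemma value_fn_eq_payoff: "\<bar>x\<bar> \<le> \<alpha> \<Longrightarrow> value_fn x = payoff x"
  using \<alpha>_less_1 by (simp add: value_fn_def payoff_def)

lemma value_fn_nonneg: "0 \<le> value_fn x"
proof -
  have "0 \<le> payoff x"
    using lam_pos by (simp add: payoff_def abs_square_le_1)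
  then show ?thesis
    using payoff_less_value_fn[of x] value_fn_eq_payoff[of x] by (cases "\<alpha> < \<bar>x\<bar>") auto
qed

lemma stop_set_W_eq: "stop_set_W payoff value_fn = {-\<alpha>..\<alpha>}"
proof -
  have "value_fn x = payoff x \<longleftrightarrow> \<bar>x\<bar> \<le> \<alpha>" for x
    using payoff_less_value_fn[of x] value_fn_eq_payoff[of x] by (cases "\<alpha> < \<bar>x\<bar>") auto
  then show ?thesis
    unfolding stop_set_W_def by (simp add: set_eq_iff abs_le_iff) linarith
qed

lemma stop_set_C_eq: "stop_set_C payoff value_fn = {}"
proof -
  have "payoff x \<le> value_fn x" for x
    using payoff_less_value_fn[of x] value_fn_eq_payoff[of x] by (cases "\<alpha> < \<bar>x\<bar>") auto
  then show ?thesis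
    by (simp add: stop_set_C_def not_less)
qed

lemma abs_slope_less: "\<bar>x\<bar> \<noteq> \<alpha> \<Longrightarrow> \<bar>slope x\<bar> < 2 * lam * \<alpha>"
proof (cases "\<bar>x\<bar> < \<alpha>")
  case True
  then show ?thesis using lam_pos by (simp add: slope_inside abs_mult)
next
  case False
  moreover assume "\<bar>x\<bar> \<noteq> \<alpha>"
  ultimately have x: "\<alpha> < \<bar>x\<bar>" by simp
  then have "\<bar>sgn x\<bar> = 1" using \<alpha>_pos by (auto simp: sgn_if)
  then have "\<bar>slope x\<bar> = 2 * lam * \<alpha> * exp (- k * (\<bar>x\<bar> - \<alpha>))"
    using x lam_pos \<alpha>_pos by (simp add: slope_outside abs_mult)
  moreover have "exp (- k * (\<bar>x\<bar> - \<alpha>)) < 1" using x k_pos by simp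
  ultimately show ?thesis using lam_pos \<alpha>_pos by simp
qed

text \<open>
  In the borderline case \<open>2 * lam * \<alpha> = 1\<close> the slope has modulus one exactly at \<open>\<alpha>\<close> and \<open>-\<alpha>\<close>, but these
  two isolated points have no interior.
\<close>

lemma control_set_eq:
  assumes "2 * lam * \<alpha> \<le> 1"
  shows "control_set {} value_fn = {}"
proof -
  have "{x. \<bar>slope x\<bar> = 1} \<subseteq> {\<alpha>, -\<alpha>}"
  proof
    fix x assume "x \<in> {x. \<bar>slope x\<bar> = 1}"
    then have "\<bar>x\<bar> = \<alpha>"
      using abs_slope_less[of x] assms by fastforce
    then show "x \<in> {\<alpha>, -\<alpha>}" by auto
  qed
  then have "finite {x. \<bar>slope x\<bar> = 1}"
    by (rule finite_subset) simp
  then show ?thesis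
    by (simp add: control_set_def deriv_value_fn empty_interior_finite)
qed

section \<open>The variational inequalities\<close>

lemma generator_value_fn_outside:
  "\<alpha> < \<bar>x\<bar> \<Longrightarrow> generator (k\<^sup>2 / 2) value_fn x = 0"
  by (simp add: generator_def deriv_value_fn slope_deriv_outside)

lemma generator_value_fn_inside:
  "\<bar>x\<bar> < \<alpha> \<Longrightarrow> generator (k\<^sup>2 / 2) value_fn x \<le> 0"
  using lam_pos mult_nonneg_nonneg[OF zero_le_power2 value_fn_nonneg, of k x]
  by (simp add: generator_def deriv_value_fn slope_deriv_inside)

text \<open>
  The generator is a local operator, and the two functions agree on an open neighbourhood.
\<close>

lemma generator_payoff_inside:
  assumes "\<bar>x\<bar> < \<alpha>"
  shows "generator d payoff x = generator d value_fn x"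
proof -
  let ?S = "{-\<alpha><..<\<alpha>}"
  have S: "open ?S" "x \<in> ?S" using assms by auto
  have der: "deriv payoff y = slope y" if "y \<in> ?S" for y
    by (intro DERIV_imp_deriv has_field_derivative_transform_within_open[OF value_fn_deriv, of ?S])
      (use that in \<open>auto simp: value_fn_eq_payoff\<close>)
  have "deriv (deriv payoff) x = deriv slope x"
    by (rule deriv_cong_ev) (use S der in \<open>auto simp: eventually_nhds\<close>)
  then show ?thesis
    using assms by (simp add: generator_def deriv_value_fn value_fn_eq_payoff)
qed

text \<open>
  For necessity, the slope is evaluated at \<open>\<alpha>\<close>, which cannot be an exceptional point because
  there are none. For sufficiency, the exceptional set is taken to be empty.
\<close>

lemma is_candidate_value_fn_iff:
  "is_candidate (k\<^sup>2 / 2) (\<lambda>x. 0) payoff value_fn \<longleftrightarrow> 2 * lam * \<alpha> \<le> 1"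
proof
  assume "is_candidate (k\<^sup>2 / 2) (\<lambda>x. 0) payoff value_fn"
  then obtain B where "B \<subseteq> stop_set_C payoff value_fn"
    and bound: "\<forall>x. x \<notin> B \<longrightarrow> \<bar>deriv value_fn x\<bar> \<le> 1"
    unfolding is_candidate_def candidate_with_def by blast
  then have "\<bar>slope \<alpha>\<bar> \<le> 1"
    by (auto simp: stop_set_C_eq deriv_value_fn)
  then show "2 * lam * \<alpha> \<le> 1"
    using \<alpha>_pos lam_pos by (simp add: slope_inside abs_mult)
next
  assume le: "2 * lam * \<alpha> \<le> 1"
  note sets = control_set_eq[OF le] stop_set_W_eq stop_set_C_eq
  have "continuous_on UNIV slope"
    using slope_lipschitz by (rule lipschitz_on_continuous_on)
  then have C1: "value_fn C1_differentiable_on UNIV"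
    unfolding C1_differentiable_on_def
    using value_fn_deriv has_real_derivative_iff_has_vector_derivative by blast
  have cont: "continuous_on UNIV value_fn"
    using value_fn_deriv DERIV_isCont by (auto simp: continuous_on_eq_continuous_at)
  have AC: "locally_abs_continuous_on UNIV slope"
    unfolding locally_abs_continuous_on_def
    using lipschitz_on_subset[OF slope_lipschitz] lipschitz_imp_abs_continuous_on by blast
  have bound: "\<bar>slope x\<bar> \<le> 1" for x
  proof (cases "\<bar>x\<bar> = \<alpha>")
    case True
    then show ?thesis using le lam_pos by (simp add: slope_inside abs_mult)
  qed (use abs_slope_less[of x] le in simp)
  have intervals: "finite_union_of_intervals {}" "finite_union_of_intervals {-\<alpha>..\<alpha>}"
    unfolding finite_union_of_intervals_def
    by (rule exI[of _ "{}"], simp) (rule exI[of _ "{{-\<alpha>..\<alpha>}}"], simp)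
  have waiting: "waiting_set {} payoff value_fn = {x. \<alpha> < \<bar>x\<bar>}"
    by (auto simp: waiting_set_def stop_set_def sets)
  have "candidate_with (k\<^sup>2 / 2) (\<lambda>x. 0) payoff {} value_fn"
    unfolding candidate_with_def sets waiting deriv_value_fn stop_set_def
    using C1 cont AC bound intervals value_fn_nonneg generator_value_fn_outside
      generator_value_fn_inside generator_payoff_inside
    by auto
  then show "is_candidate (k\<^sup>2 / 2) (\<lambda>x. 0) payoff value_fn"
    unfolding is_candidate_def by blast
qed

end

section \<open>The characterisation\<close>

theorem proposition6:
  fixes \<delta> lam \<alpha> A :: real and h g u :: "real \<Rightarrow> real"
  assumes "\<delta> > 0" and "lam > 0"
    and "h = (\<lambda>x. 0)"
    and "g = (\<lambda>x. if \<bar>x\<bar> \<le> 1 then lam - lam * x\<^sup>2 else 0)"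
    and "\<alpha> = - (1 / sqrt (2 * \<delta>)) + sqrt (1 / (2 * \<delta>) + 1)"
    and "A = lam * (1 - \<alpha>\<^sup>2) * exp (sqrt (2 * \<delta>) * \<alpha>)"
    and "u = (\<lambda>x. if \<bar>x\<bar> \<le> \<alpha> then - lam * x\<^sup>2 + lam else A * exp (- sqrt (2 * \<delta>) * \<bar>x\<bar>))"
  shows "0 < \<alpha> \<and> \<alpha> < 1 \<and> A > 0 \<and>
    (is_candidate \<delta> h g u \<longleftrightarrow> \<alpha> \<le> 1 / (2 * lam)) \<and>
    (\<alpha> \<le> 1 / (2 * lam) \<longleftrightarrow>
      lam \<le> 1/2 * inverse (- (1 / sqrt (2 * \<delta>)) + sqrt (1 / (2 * \<delta>) + 1)))"
proof -
  define k where "k = sqrt (2 * \<delta>)"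
  have k: "k > 0" "k\<^sup>2 = 2 * \<delta>" using \<open>\<delta> > 0\<close> by (simp_all add: k_def)
  have "\<alpha> = - (1 / k) + sqrt (1 / k\<^sup>2 + 1)"
    using assms(5) unfolding k(2) by (simp add: k_def)
  note \<alpha> = threshold_properties[OF k(1) this]
  interpret smooth_fit k lam \<alpha>
    using k(1) \<open>lam > 0\<close> \<alpha> by unfold_locales
  have "1 - \<alpha>\<^sup>2 > 0"
    using \<alpha> by (simp add: power_less_one_iff)
  then have A: "A > 0"
    using assms(6) \<open>lam > 0\<close> by simp
  have "g = payoff"
    using assms(4) by (simp add: payoff_def fun_eq_iff)
  moreover have "u = value_fn"
  proof
    fix x
    \<comment> \<open>The constant \<open>A\<close> absorbs the shift of the exponential to its starting point \<open>\<alpha>\<close>.\<close>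
    have "exp (k * \<alpha>) * exp (- k * \<bar>x\<bar>) = exp (- k * (\<bar>x\<bar> - \<alpha>))"
      by (simp add: right_diff_distrib flip: exp_add)
    then show "u x = value_fn x"
      unfolding assms(6,7) k_def[symmetric] value_fn_def by (simp add: mult.assoc)
  qed
  moreover have "\<delta> = k\<^sup>2 / 2" using k(2) by simp
  ultimately have "is_candidate \<delta> h g u \<longleftrightarrow> 2 * lam * \<alpha> \<le> 1"
    using is_candidate_value_fn_iff assms(3) by metis
  moreover have "2 * lam * \<alpha> \<le> 1 \<longleftrightarrow> \<alpha> \<le> 1 / (2 * lam)"
    using \<open>lam > 0\<close> by (simp add: field_simps)
  moreover have "2 * lam * \<alpha> \<le> 1 \<longleftrightarrow> lam \<le> 1/2 * inverse \<alpha>"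
    using \<alpha>(1) by (simp add: field_simps)
  ultimately show ?thesis
    using \<alpha>(1,2) A unfolding assms(5)[symmetric] by blast
qed

end
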